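(* For all positive integers $m,q$ with $mq>1$, $$\pi_f(K_{m+1,qm})=3\left(1-\frac{(q+1)m-2}{(2m+1)mq-m-2}\right).$$
   Context: $K_{a,b}$ is the complete bipartite graph with parts of sizes $a$ and $b$. Two edges are nonincident if they share no endpoint. A linear ordering of $V(G)$ separates a pair of nonincident edges if both endpoints of one edge precede both endpoints of the other. $\pi_t(G)$ is the minimum length of a list of linear orderings of $V(G)$ (repetitions allowed) separating every pair of nonincident edges at least $t$ times, and the fractional separation dimension is $\pi_f(G)=\liminf_{t\to\infty}\pi_t(G)/t$. *)

theory Defs
  imports Complex_Main "HOL-Library.Extended_Real"
begin

text \<open>
  A finite simple graph is given by its vertex set \<open>V\<close> and its set \<open>E\<close> of edges, each edge being
  the two-element set of its endpoints. A linear ordering of \<open>V\<close> is a relation \<open>r\<close> with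
  \<open>linear_order_on V r\<close>; these are reflexive, so strict precedence of \<open>x\<close> before \<open>y\<close> is
  \<open>(x, y) \<in> r \<and> x \<noteq> y\<close>.
\<close>

definition nonincident :: "'a set \<Rightarrow> 'a set \<Rightarrow> bool" where
  "nonincident e f \<longleftrightarrow> e \<inter> f = {}"

definition all_precede :: "('a \<times> 'a) set \<Rightarrow> 'a set \<Rightarrow> 'a set \<Rightarrow> bool" where
  "all_precede r e f \<longleftrightarrow> (\<forall>x\<in>e. \<forall>y\<in>f. (x, y) \<in> r \<and> x \<noteq> y)"

definition separates :: "('a \<times> 'a) set \<Rightarrow> 'a set \<Rightarrow> 'a set \<Rightarrow> bool" where
  "separates r e f \<longleftrightarrow> all_precede r e f \<or> all_precede r f e"

definition separating_list :: "'a set \<Rightarrow> 'a set set \<Rightarrow> nat \<Rightarrow> ('a \<times> 'a) set list \<Rightarrow> bool" where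
  "separating_list V E t rs \<longleftrightarrow>
     (\<forall>r\<in>set rs. linear_order_on V r) \<and>
     (\<forall>e\<in>E. \<forall>f\<in>E. nonincident e f \<longrightarrow> t \<le> length (filter (\<lambda>r. separates r e f) rs))"

text \<open>
  For a finite graph the minimum below is over a nonempty set, since any two nonincident edges
  are separated by some linear ordering.
\<close>

definition sep_dim :: "nat \<Rightarrow> 'a set \<Rightarrow> 'a set set \<Rightarrow> nat" where
  "sep_dim t V E = (LEAST n. \<exists>rs. length rs = n \<and> separating_list V E t rs)"

definition frac_sep_dim :: "'a set \<Rightarrow> 'a set set \<Rightarrow> ereal" where
  "frac_sep_dim V E = liminf (\<lambda>t. ereal (real (sep_dim t V E) / real t))"

definition complete_bipartite_verts :: "nat \<Rightarrow> nat \<Rightarrow> (nat + nat) set" where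
  "complete_bipartite_verts a b = {..<a} <+> {..<b}"

definition complete_bipartite_edges :: "nat \<Rightarrow> nat \<Rightarrow> (nat + nat) set set" where
  "complete_bipartite_edges a b = {{Inl i, Inr j} | i j. i < a \<and> j < b}"

end

theory Submission imports Defs "HOL-Combinatorics.Transposition" begin

text \<open>
  The graph is transitive on ordered pairs of nonincident edges, so the family of all orderings that
  separate the maximal number \<open>M\<close> of such pairs separates each of them equally often. By double
  counting the fractional separation dimension is the number of all pairs divided by \<open>M\<close>.

  Of the two perfect matchings on vertices \<open>i, i'\<close> of \<open>A\<close> and \<open>j, j'\<close> of \<open>B\<close>, an ordering separates
  exactly one, unless \<open>i, i'\<close> both precede or both follow \<open>j, j'\<close>, when it separates none. If the
  \<open>k\<close>-th vertex of \<open>A\<close> (\<open>0 \<le> k \<le> m\<close>) has \<open>x\<close> vertices of \<open>B\<close> before it, it accounts for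
  \<open>(m - k) C(x, 2) + k C(q m - x, 2)\<close> bad quadruples. Each of these terms is minimal at \<open>x = k q\<close>,
  and all minima are attained by one ordering.
\<close>

section \<open>Pairs of nonincident edges as quadruples of vertices\<close>

definition strictly_before :: "('a \<times> 'a) set \<Rightarrow> 'a \<Rightarrow> 'a \<Rightarrow> bool" where
  "strictly_before r x y \<longleftrightarrow> (x, y) \<in> r \<and> x \<noteq> y"

text \<open>The quadruple stands for the ordered pair of edges \<open>{i, j}\<close>,
  \<open>{i', j'}\<close>. Every unordered pair of nonincident edges thus occurs twice, and this
  factor cancels in the final ratio.\<close>

definition edge_quads :: "'a set \<Rightarrow> 'a set \<Rightarrow> ('a \<times> 'a \<times> 'a \<times> 'a) set" where
  "edge_quads A B = {(i, i', j, j'). i \<in> A \<and> i' \<in> A \<and> i \<noteq> i' \<and> j \<in> B \<and> j' \<in> B \<and> j \<noteq> j'}"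

definition quad_sep :: "('a \<times> 'a) set \<Rightarrow> 'a \<times> 'a \<times> 'a \<times> 'a \<Rightarrow> bool" where
  "quad_sep r = (\<lambda>(i, i', j, j'). separates r {i, j} {i', j'})"

definition sep_quads :: "'a set \<Rightarrow> 'a set \<Rightarrow> ('a \<times> 'a) set \<Rightarrow> ('a \<times> 'a \<times> 'a \<times> 'a) set" where
  "sep_quads A B r = {p \<in> edge_quads A B. quad_sep r p}"

lemma card_off_diagonal:
  assumes "finite S"
  shows "card {(x, y). x \<in> S \<and> y \<in> S \<and> x \<noteq> y} = card S * (card S - 1)"
proof -
  have "{(x, y). x \<in> S \<and> y \<in> S \<and> x \<noteq> y} = (SIGMA x:S. S - {x})" by auto
  then show ?thesis using assms by (simp add: card_SigmaI)
qed

lemma finite_edge_quads: "finite A \<Longrightarrow> finite B \<Longrightarrow> finite (edge_quads A B)"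
  by (rule finite_subset[of _ "A \<times> A \<times> B \<times> B"]) (auto simp: edge_quads_def)

lemma card_edge_quads:
  assumes "finite A" "finite B"
  shows "card (edge_quads A B) = card A * (card A - 1) * (card B * (card B - 1))"
proof -
  let ?D = "\<lambda>S. {(x, y). x \<in> S \<and> y \<in> S \<and> x \<noteq> y}"
  have "edge_quads A B = (\<lambda>((i, i'), (j, j')). (i, i', j, j')) ` (?D A \<times> ?D B)"
    by (force simp: edge_quads_def)
  moreover have "inj_on (\<lambda>((i, i'), (j, j')). (i, i', j, j')) (?D A \<times> ?D B)"
    by (auto simp: inj_on_def)
  ultimately show ?thesis
    using assms by (simp add: card_image card_cartesian_product card_off_diagonal)
qed

section \<open>Counting the quadruples that one ordering separates\<close>

locale ordered_bipartition =
  fixes A B :: "'a set" and r :: "('a \<times> 'a) set"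
  assumes finA: "finite A" and finB: "finite B" and disj: "A \<inter> B = {}"
    and lin: "linear_order_on (A \<union> B) r"
begin

abbreviation lt (infix "\<prec>" 50) where "x \<prec> y \<equiv> strictly_before r x y"

lemma lt_irrefl: "\<not> x \<prec> x"
  by (simp add: strictly_before_def)

lemma lt_trans: "x \<prec> y \<Longrightarrow> y \<prec> z \<Longrightarrow> x \<prec> z"
  using lin unfolding strictly_before_def linear_order_on_def partial_order_on_def preorder_on_def
    trans_def antisym_def by blast

lemma lt_asym: "x \<prec> y \<Longrightarrow> \<not> y \<prec> x"
  using lt_trans lt_irrefl by blast

lemma lt_total: "x \<in> A \<union> B \<Longrightarrow> y \<in> A \<union> B \<Longrightarrow> x \<noteq> y \<Longrightarrow> x \<prec> y \<or> y \<prec> x"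
  using lin unfolding strictly_before_def linear_order_on_def total_on_def by blast

definition increasing_pairs :: "'a set \<Rightarrow> ('a \<times> 'a) set" where
  "increasing_pairs S = {(x, y). x \<in> S \<and> y \<in> S \<and> x \<prec> y}"

lemma card_increasing_pairs:
  assumes "finite S" "S \<subseteq> A \<union> B"
  shows "2 * card (increasing_pairs S) = card S * (card S - 1)"
proof -
  let ?I = "increasing_pairs S"
  have fin: "finite ?I"
    by (rule finite_subset[of _ "S \<times> S"]) (auto simp: increasing_pairs_def assms)
  have "{(x, y). x \<in> S \<and> y \<in> S \<and> x \<noteq> y} = ?I \<union> ?I\<inverse>"
  proof (intro set_eqI iffI)
    fix p assume "p \<in> {(x, y). x \<in> S \<and> y \<in> S \<and> x \<noteq> y}"
    then obtain x y where p: "p = (x, y)" "x \<in> S" "y \<in> S" "x \<noteq> y" by blast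
    then have "x \<prec> y \<or> y \<prec> x" using lt_total assms(2) by (meson subsetD)
    then show "p \<in> ?I \<union> ?I\<inverse>" using p by (auto simp: increasing_pairs_def)
  qed (auto simp: increasing_pairs_def lt_irrefl)
  moreover have "?I \<inter> ?I\<inverse> = {}"
    using lt_asym by (auto simp: increasing_pairs_def)
  ultimately show ?thesis
    using card_off_diagonal[OF assms(1)] fin by (simp add: card_Un_disjoint)
qed

definition rank :: "'a \<Rightarrow> nat" where
  "rank i = card {i' \<in> A. i' \<prec> i}"

definition Bs_before :: "'a \<Rightarrow> nat" where
  "Bs_before i = card {j \<in> B. j \<prec> i}"

text \<open>Strict growth along the ordering gives injectivity, and equal cardinalities give
  surjectivity. Reindexing by this bijection turns sums over vertices of \<open>A\<close> into sums
  over positions.\<close>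

lemma bij_rank: "bij_betw rank A {..<card A}"
proof -
  have mono: "rank i < rank i'" if "i \<in> A" "i' \<in> A" "i \<prec> i'" for i i'
  proof -
    have "{i'' \<in> A. i'' \<prec> i} \<subseteq> {i'' \<in> A. i'' \<prec> i'}"
      using that lt_trans by blast
    moreover have "i \<in> {i'' \<in> A. i'' \<prec> i'}" "i \<notin> {i'' \<in> A. i'' \<prec> i}"
      using that lt_irrefl by auto
    ultimately show ?thesis
      unfolding rank_def using finA by (intro psubset_card_mono) auto
  qed
  have inj: "inj_on rank A"
    using mono lt_total by (metis UnI1 inj_onI nless_le)
  have "rank i < card A" if "i \<in> A" for i
    unfolding rank_def using that finA lt_irrefl
    by (intro psubset_card_mono) auto
  then have "rank ` A \<subseteq> {..<card A}" by auto
  then have "rank ` A = {..<card A}"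
    using inj finA by (intro card_subset_eq) (auto simp: card_image)
  with inj show ?thesis by (simp add: bij_betw_def)
qed

lemma card_above:
  assumes "i \<in> A"
  shows "card {i' \<in> A. i \<prec> i'} + rank i + 1 = card A"
proof -
  have "A = insert i ({i' \<in> A. i \<prec> i'} \<union> {i' \<in> A. i' \<prec> i})"
    using assms lt_total by blast
  moreover have "card (insert i ({i' \<in> A. i \<prec> i'} \<union> {i' \<in> A. i' \<prec> i}))
      = Suc (card {i' \<in> A. i \<prec> i'} + card {i' \<in> A. i' \<prec> i})"
    using finA lt_irrefl lt_asym by (subst card_insert_disjoint) (auto intro!: card_Un_disjoint)
  ultimately show ?thesis by (simp add: rank_def)
qed

lemma card_Bs_after:
  assumes "i \<in> A"
  shows "card {j \<in> B. i \<prec> j} + Bs_before i = card B"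
proof -
  have "B = {j \<in> B. i \<prec> j} \<union> {j \<in> B. j \<prec> i}"
    using assms lt_total disj by blast
  moreover have "card ({j \<in> B. i \<prec> j} \<union> {j \<in> B. j \<prec> i})
      = card {j \<in> B. i \<prec> j} + card {j \<in> B. j \<prec> i}"
    using finB lt_asym by (intro card_Un_disjoint) auto
  ultimately show ?thesis by (simp add: Bs_before_def)
qed

text \<open>
  Twice the number of pairs from \<open>A\<close> lying entirely on one side of a pair from \<open>B\<close>,
  grouped by the vertex of \<open>A\<close> that is nearer to the \<open>B\<close>-pair.
\<close>

definition deficit :: real where
  "deficit = (\<Sum>i\<in>A.
     (real (card A) - 1 - real (rank i)) * (real (Bs_before i) * (real (Bs_before i) - 1)) +
     real (rank i) * ((real (card B) - real (Bs_before i)) * (real (card B) - real (Bs_before i) - 1)))"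

text \<open>Swapping the two edges halves the count to quadruples whose first edge comes first
  (\<open>N\<close>). Among all choices of increasing pairs (\<open>All\<close>), those outside
  \<open>N\<close> have the \<open>B\<close>-pair entirely below the \<open>A\<close>-pair
  (\<open>Lo\<close>) or entirely above it (\<open>Hi\<close>). The two exceptional families
  together have half of \<open>deficit\<close> many elements.\<close>

lemma card_sep_quads:
  "real (card (sep_quads A B r)) =
     real (card A) * (real (card A) - 1) * (real (card B) * (real (card B) - 1)) / 2 - deficit"
proof -
  define Q where "Q = A \<times> A \<times> B \<times> B"
  have finQ: "finite Q" using finA finB by (simp add: Q_def)
  define N where "N = {(i, i', j, j') \<in> Q. i \<prec> i' \<and> i \<prec> j' \<and> j \<prec> i' \<and> j \<prec> j'}"
  define All where "All = {(i, i', j, j') \<in> Q. i \<prec> i' \<and> j \<prec> j'}"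
  define Lo where "Lo = {(i, i', j, j') \<in> Q. j \<prec> j' \<and> j' \<prec> i \<and> i \<prec> i'}"
  define Hi where "Hi = {(i, i', j, j') \<in> Q. i \<prec> i' \<and> i' \<prec> j \<and> j \<prec> j'}"
  have fin: "finite N" "finite Lo" "finite Hi"
    by (auto intro!: finite_subset[OF _ finQ] simp: N_def Lo_def Hi_def)
  have pair: "real (card (increasing_pairs S)) = real (card S) * (real (card S) - 1) / 2"
    if "finite S" "S \<subseteq> A \<union> B" for S
    using arg_cong[OF card_increasing_pairs[OF that], of real]
    by (cases "card S") (auto simp: algebra_simps)

  have "sep_quads A B r = N \<union> (\<lambda>(i, i', j, j'). (i', i, j', j)) ` N"
    (is "_ = _ \<union> ?s ` _")
  proof (intro set_eqI iffI)
    fix p assume "p \<in> sep_quads A B r"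
    moreover obtain i i' j j' where p: "p = (i, i', j, j')" by (cases p)
    ultimately have "(i, i', j, j') \<in> N \<or> (i', i, j', j) \<in> N"
      by (auto simp: sep_quads_def quad_sep_def edge_quads_def separates_def all_precede_def
          N_def Q_def strictly_before_def)
    then show "p \<in> N \<union> ?s ` N" using p by force
  next
    fix p assume "p \<in> N \<union> ?s ` N"
    then show "p \<in> sep_quads A B r"
      using disj by (auto simp: sep_quads_def quad_sep_def edge_quads_def separates_def
          all_precede_def N_def Q_def strictly_before_def)
  qed
  moreover have "N \<inter> ?s ` N = {}"
    using lt_asym by (auto simp: N_def)
  moreover have "card (?s ` N) = card N"
    by (intro card_image) (auto simp: inj_on_def)
  ultimately have sep: "card (sep_quads A B r) = 2 * card N"
    using fin by (simp add: card_Un_disjoint)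

  \<comment> \<open>An increasing choice leaves \<open>N\<close> only through \<open>j'\<close>
    before \<open>i\<close> or \<open>i'\<close> before \<open>j\<close>. Either one forces the
    position of all four vertices.\<close>
  have "All = N \<union> (Lo \<union> Hi)"
  proof (intro set_eqI iffI)
    fix p assume "p \<in> All"
    moreover obtain i i' j j' where p: "p = (i, i', j, j')" by (cases p)
    ultimately have *: "i \<in> A" "i' \<in> A" "j \<in> B" "j' \<in> B" "i \<prec> i'" "j \<prec> j'"
      by (auto simp: All_def Q_def)
    then have "i \<prec> j' \<or> j' \<prec> i" "j \<prec> i' \<or> i' \<prec> j"
      using lt_total disj by (metis UnI1 UnI2 disjoint_iff)+
    then show "p \<in> N \<union> (Lo \<union> Hi)"
      using * p by (auto simp: N_def Lo_def Hi_def Q_def)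
  qed (auto simp: N_def Lo_def Hi_def All_def intro: lt_trans)
  moreover have "N \<inter> (Lo \<union> Hi) = {}"
    using lt_asym by (auto simp: N_def Lo_def Hi_def)
  moreover have "Lo \<inter> Hi = {}"
  proof -
    have False if "j \<prec> j'" "j' \<prec> i" "i \<prec> i'" "i' \<prec> j" for i i' j j'
      using that lt_trans lt_asym by meson
    then show ?thesis by (auto simp: Lo_def Hi_def)
  qed
  ultimately have All: "card All = card N + (card Lo + card Hi)"
    using fin by (simp add: card_Un_disjoint)

  have "All = (\<lambda>((i, i'), (j, j')). (i, i', j, j')) ` (increasing_pairs A \<times> increasing_pairs B)"
    by (force simp: All_def increasing_pairs_def Q_def)
  moreover have "inj_on (\<lambda>((i, i'), (j, j')). (i, i', j, j')) (increasing_pairs A \<times> increasing_pairs B)"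
    by (auto simp: inj_on_def)
  ultimately have "card All = card (increasing_pairs A) * card (increasing_pairs B)"
    by (simp add: card_image card_cartesian_product)
  then have "real (card All) = real (card (increasing_pairs A)) * real (card (increasing_pairs B))"
    by simp
  also have "\<dots> = real (card A) * (real (card A) - 1) * (real (card B) * (real (card B) - 1)) / 4"
    by (simp only: pair[OF finA Un_upper1] pair[OF finB Un_upper2]) simp
  finally have cAll: "real (card All) = \<dots>" .

  have finI: "finite (increasing_pairs {j \<in> B. P j})" for P
    by (rule finite_subset[of _ "B \<times> B"]) (auto simp: increasing_pairs_def finB)
  \<comment> \<open>The nearer vertex of the \<open>A\<close>-pair is here the lower one,
    \<open>i\<close>; its partner is any later vertex of \<open>A\<close>.\<close>
  let ?lo = "SIGMA i:A. {i' \<in> A. i \<prec> i'} \<times> increasing_pairs {j \<in> B. j \<prec> i}"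
  have "j \<prec> i" if "j \<prec> j'" "j' \<prec> i" for i j j'
    using that by (rule lt_trans)
  then have "Lo = ?lo"
    by (auto simp: Lo_def increasing_pairs_def Q_def)
  then have "card Lo = card ?lo" by simp
  also have "\<dots> = (\<Sum>i\<in>A. card {i' \<in> A. i \<prec> i'} * card (increasing_pairs {j \<in> B. j \<prec> i}))"
    using finA finI by (subst card_SigmaI) (auto simp: card_cartesian_product)
  finally have "real (card Lo) =
      (\<Sum>i\<in>A. real (card {i' \<in> A. i \<prec> i'}) * real (card (increasing_pairs {j \<in> B. j \<prec> i})))"
    by simp
  also have "\<dots> = (\<Sum>i\<in>A. (real (card A) - 1 - real (rank i)) *
      (real (Bs_before i) * (real (Bs_before i) - 1)) / 2)"
  proof (intro sum.cong refl)
    fix i assume i: "i \<in> A"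
    have "real (card {i' \<in> A. i \<prec> i'}) = real (card A) - 1 - real (rank i)"
      using arg_cong[OF card_above[OF i], of real] by simp
    moreover have "{j \<in> B. j \<prec> i} \<subseteq> A \<union> B" by auto
    ultimately show "real (card {i' \<in> A. i \<prec> i'}) * real (card (increasing_pairs {j \<in> B. j \<prec> i})) =
        (real (card A) - 1 - real (rank i)) * (real (Bs_before i) * (real (Bs_before i) - 1)) / 2"
      using finB by (simp add: pair Bs_before_def)
  qed
  finally have cLo: "real (card Lo) = \<dots>" .

  \<comment> \<open>Now the nearer vertex is the upper one, \<open>i'\<close>, and its partner is
    any earlier vertex of \<open>A\<close>, which gives \<open>rank\<close> choices.\<close>
  let ?hi = "SIGMA i':A. {i \<in> A. i \<prec> i'} \<times> increasing_pairs {j \<in> B. i' \<prec> j}"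
  have "i' \<prec> j'" if "i' \<prec> j" "j \<prec> j'" for i' j j'
    using that by (rule lt_trans)
  then have "Hi = (\<lambda>(i', i, p). (i, i', p)) ` ?hi"
    by (auto simp: Hi_def increasing_pairs_def Q_def image_iff)
  moreover have "inj_on (\<lambda>(i', i, p). (i, i', p)) ?hi"
    by (auto simp: inj_on_def)
  ultimately have "card Hi = card ?hi" by (simp add: card_image)
  also have "\<dots> = (\<Sum>i\<in>A. rank i * card (increasing_pairs {j \<in> B. i \<prec> j}))"
    using finA finI by (subst card_SigmaI) (auto simp: card_cartesian_product rank_def)
  finally have "real (card Hi) =
      (\<Sum>i\<in>A. real (rank i) * real (card (increasing_pairs {j \<in> B. i \<prec> j})))"
    by simp
  also have "\<dots> = (\<Sum>i\<in>A. real (rank i) *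
      ((real (card B) - real (Bs_before i)) * (real (card B) - real (Bs_before i) - 1)) / 2)"
  proof (intro sum.cong refl)
    fix i assume i: "i \<in> A"
    have "real (card {j \<in> B. i \<prec> j}) = real (card B) - real (Bs_before i)"
      using arg_cong[OF card_Bs_after[OF i], of real] by simp
    moreover have "{j \<in> B. i \<prec> j} \<subseteq> A \<union> B" by auto
    ultimately show "real (rank i) * real (card (increasing_pairs {j \<in> B. i \<prec> j})) = real (rank i) *
      ((real (card B) - real (Bs_before i)) * (real (card B) - real (Bs_before i) - 1)) / 2"
      using finB by (simp add: pair)
  qed
  finally have cHi: "real (card Hi) = \<dots>" .

  have "real (card Lo) + real (card Hi) = deficit / 2"
    unfolding cLo cHi deficit_def sum_divide_distrib sum.distrib[symmetric] add_divide_distrib ..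
  then show ?thesis using sep All cAll by simp
qed

end

section \<open>Minimising the deficit\<close>

text \<open>This is the summand of \<open>deficit\<close> at a vertex of rank \<open>k\<close> with
  \<open>y\<close> vertices of \<open>B\<close> before it, for parts of sizes \<open>m + 1\<close>
  and \<open>q * m\<close>. A real \<open>y\<close> keeps the subtractions from truncating.\<close>

definition deficit_term :: "nat \<Rightarrow> nat \<Rightarrow> nat \<Rightarrow> real \<Rightarrow> real" where
  "deficit_term m q k y = (real m - real k) * (y * (y - 1)) +
     real k * ((real (q * m) - y) * (real (q * m) - y - 1))"

text \<open>
  With \<open>d = x - k q\<close> the difference of the two sides is \<open>d (m d - (m - 2 k))\<close>, which is
  nonnegative because \<open>d\<close> is an integer and \<open>\<bar>m - 2 k\<bar> \<le> m\<close>.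
\<close>

lemma deficit_term_ge:
  assumes "k \<le> m"
  shows "deficit_term m q k (real (k * q)) \<le> deficit_term m q k (real x)"
proof -
  define d where "d = int x - int (k * q)"
  have "deficit_term m q k (real x) - deficit_term m q k (real (k * q)) =
      real_of_int (d * (int m * d - (int m - 2 * int k)))"
    unfolding deficit_term_def d_def by (simp add: algebra_simps power2_eq_square)
  moreover have "0 \<le> d * (int m * d - (int m - 2 * int k))"
  proof -
    consider "d = 0" | "d \<ge> 1" | "d \<le> -1" by linarith
    then show ?thesis
    proof cases
      case 2
      then have "int m * 1 \<le> int m * d" by (intro mult_left_mono) auto
      then show ?thesis using 2 by (intro mult_nonneg_nonneg) auto
    next
      case 3
      then have "int m * d \<le> int m * (-1)" by (intro mult_left_mono) auto
      then show ?thesis using 3 assms(1) by (intro mult_nonpos_nonpos) auto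
    qed simp
  qed
  ultimately show ?thesis by (smt (verit) of_int_0_le_iff)
qed

definition min_deficit :: "nat \<Rightarrow> nat \<Rightarrow> real" where
  "min_deficit m q = real q * real m * ((real m)\<^sup>2 - 1) * (real q * real m - 2) / 6"

text \<open>At \<open>y = k q\<close> both products contain q k (m - k), and the remaining factors
  add up to q m - 2. What is left is the sum of k (m - k), which equals m (m^2 - 1) / 6.\<close>

lemma sum_deficit_terms:
  "(\<Sum>k<m + 1. deficit_term m q k (real (k * q))) = min_deficit m q"
proof -
  have summand: "deficit_term m q k (real (k * q)) =
      real q * (real q * real m - 2) * (real m * real k - (real k)\<^sup>2)" for k
    unfolding deficit_term_def by (simp add: algebra_simps power2_eq_square)
  \<comment> \<open>The coefficient \<open>c\<close> is separated from the length \<open>n\<close>,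
    since \<open>m\<close> plays both roles in the sum and an induction on it would change
    both.\<close>
  have sums: "(\<Sum>k<n. c * real k - (real k)\<^sup>2) =
      c * (real n * (real n - 1) / 2) - real n * (real n - 1) * (2 * real n - 1) / 6" for n c
    by (induction n) (auto simp: field_simps power2_eq_square)
  have "(\<Sum>k<m + 1. deficit_term m q k (real (k * q))) = real q * (real q * real m - 2) *
      (\<Sum>k<m + 1. real m * real k - (real k)\<^sup>2)"
    unfolding summand by (rule sum_distrib_left[symmetric])
  also have "\<dots> = min_deficit m q"
    unfolding sums min_deficit_def by (simp add: field_simps power2_eq_square)
  finally show ?thesis .
qed


definition max_separated :: "nat \<Rightarrow> nat \<Rightarrow> real" where
  "max_separated m q =
     (real m + 1) * real m * (real (q * m) * (real (q * m) - 1)) / 2 - min_deficit m q"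

context ordered_bipartition
begin

lemma min_deficit_eq_sum_rank:
  assumes "card A = m + 1"
  shows "min_deficit m q = (\<Sum>i\<in>A. deficit_term m q (rank i) (real (rank i * q)))"
proof -
  have "min_deficit m q = (\<Sum>k\<in>{..<card A}. deficit_term m q k (real (k * q)))"
    using sum_deficit_terms[of m q] assms by simp
  also have "\<dots> = (\<Sum>i\<in>A. deficit_term m q (rank i) (real (rank i * q)))"
    by (rule sum.reindex_bij_betw[OF bij_rank, symmetric])
  finally show ?thesis .
qed

text \<open>The bound is taken vertex by vertex, as if the values of \<open>Bs_before\<close> could
  be chosen independently. This relaxation loses nothing, because the minimisers \<open>k q\<close>
  increase with the rank.\<close>

lemma card_sep_quads_le:
  assumes cA: "card A = m + 1" and cB: "card B = q * m"
  shows "real (card (sep_quads A B r)) \<le> max_separated m q"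
proof -
  let ?g = "deficit_term m q"
  have "min_deficit m q = (\<Sum>i\<in>A. ?g (rank i) (real (rank i * q)))"
    by (rule min_deficit_eq_sum_rank[OF cA])
  also have "\<dots> \<le> (\<Sum>i\<in>A. ?g (rank i) (real (Bs_before i)))"
  proof (rule sum_mono)
    fix i assume "i \<in> A"
    then have "rank i \<le> m" using bij_betwE[OF bij_rank] cA by fastforce
    then show "?g (rank i) (real (rank i * q)) \<le> ?g (rank i) (real (Bs_before i))"
      by (rule deficit_term_ge)
  qed
  also have "\<dots> = deficit"
    by (simp add: deficit_def deficit_term_def cA cB)
  finally show ?thesis
    using card_sep_quads by (simp add: max_separated_def cA cB add.commute)
qed

lemma card_sep_quads_eq:
  assumes cA: "card A = m + 1" and cB: "card B = q * m"
    and bal: "\<And>i. i \<in> A \<Longrightarrow> Bs_before i = rank i * q"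
  shows "real (card (sep_quads A B r)) = max_separated m q"
proof -
  let ?g = "deficit_term m q"
  have "min_deficit m q = (\<Sum>i\<in>A. ?g (rank i) (real (rank i * q)))"
    by (rule min_deficit_eq_sum_rank[OF cA])
  also have "\<dots> = deficit"
    by (simp add: deficit_def deficit_term_def cA cB bal)
  finally show ?thesis
    using card_sep_quads by (simp add: max_separated_def cA cB add.commute)
qed

end

section \<open>An ordering that attains the minimum\<close>

lemma linear_order_on_key:
  fixes key :: "'a \<Rightarrow> nat"
  assumes "inj_on key V"
  shows "linear_order_on V {(x, y). x \<in> V \<and> y \<in> V \<and> key x \<le> key y}"
  using assms
  by (auto simp: linear_order_on_def partial_order_on_def preorder_on_def refl_on_def trans_def
      antisym_def total_on_def inj_on_def)

lemma card_bij_less: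
  fixes h :: "'a \<Rightarrow> nat"
  assumes "bij_betw h S {0..<n}" "k \<le> n"
  shows "card {x \<in> S. h x < k} = k"
proof -
  have "bij_betw h {x \<in> S. h x < k} {0..<k}"
    using assms by (auto simp: bij_betw_def inj_on_def image_iff set_eq_iff) (metis le_trans not_le)+
  then show ?thesis by (simp add: bij_betw_same_card)
qed

text \<open>
  The optimal ordering starts with a vertex of \<open>A\<close> and puts a block of \<open>q\<close> vertices of \<open>B\<close>
  between any two consecutive vertices of \<open>A\<close>.
\<close>

lemma ex_optimal_order:
  assumes "finite A" "finite B" "A \<inter> B = {}"
    and cA: "card A = m + 1" and cB: "card B = q * m" and q: "q > 0"
  shows "\<exists>r. linear_order_on (A \<union> B) r \<and> real (card (sep_quads A B r)) = max_separated m q"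
proof -
  obtain f where f: "bij_betw f A {0..<m + 1}"
    using ex_bij_betw_finite_nat[OF assms(1)] cA by auto
  obtain g where g: "bij_betw g B {0..<q * m}"
    using ex_bij_betw_finite_nat[OF assms(2)] cB by auto
  \<comment> \<open>Multiples of \<open>q + 1\<close> are the slots of \<open>A\<close>, the other
    numbers those of \<open>B\<close>. The summand \<open>n div q + 1\<close> counts the vertices of
    \<open>A\<close> that precede vertex number \<open>n\<close> of \<open>B\<close>, numbering from
    0.\<close>
  define key where "key x = (if x \<in> A then f x * (q + 1) else g x + g x div q + 1)" for x
  have keyA: "key x = f x * (q + 1)" if "x \<in> A" for x using that by (simp add: key_def)
  have keyB: "key x = g x + g x div q + 1" if "x \<in> B" for x
    using that assms(3) by (auto simp: key_def)
  have lt: "n + n div q + 1 < k * (q + 1)" if "n < k * q" for n k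
  proof -
    have "n div q < k" using that q by (simp add: less_mult_imp_div_less)
    then show ?thesis using that by (simp add: algebra_simps)
  qed
  have gt: "n + n div q + 1 > k * (q + 1)" if "n \<ge> k * q" for n k
  proof -
    have "k \<le> n div q" using that q by (simp add: less_eq_div_iff_mult_less_eq)
    then show ?thesis using that by (simp add: algebra_simps)
  qed
  have iff: "n + n div q + 1 < k * (q + 1) \<longleftrightarrow> n < k * q" for n k
    using lt gt by (meson less_asym not_le)
  have ne: "n + n div q + 1 \<noteq> k * (q + 1)" for n k
    using lt[of n k] gt[of k n] by (metis less_irrefl not_le)
  have mono: "n + n div q + 1 < n' + n' div q + 1" if "n < n'" for n n'
    using that div_le_mono[of n n' q] by linarith
  have inj: "inj_on key (A \<union> B)"
  proof (rule inj_onI)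
    fix x y assume xy: "x \<in> A \<union> B" "y \<in> A \<union> B" "key x = key y"
    consider "x \<in> A" "y \<in> A" | "x \<in> B" "y \<in> B" | "x \<in> A" "y \<in> B" | "x \<in> B" "y \<in> A"
      using xy by blast
    then show "x = y"
    proof cases
      case 1
      then have "f x = f y" using xy(3) by (simp add: keyA del: mult_Suc_right)
      then show ?thesis using 1 f by (auto simp: bij_betw_def inj_on_def)
    next
      case 2
      then have "g x = g y" using xy(3) mono by (metis keyB less_irrefl linorder_neqE_nat)
      then show ?thesis using 2 g by (auto simp: bij_betw_def inj_on_def)
    next
      case 3 then show ?thesis using xy(3) ne by (metis keyA keyB)
    next
      case 4 then show ?thesis using xy(3) ne by (metis keyA keyB)
    qed
  qed
  define r where "r = {(x, y). x \<in> A \<union> B \<and> y \<in> A \<union> B \<and> key x \<le> key y}"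
  interpret ordered_bipartition A B r
    using assms linear_order_on_key[OF inj] by unfold_locales (auto simp: r_def)
  have before: "strictly_before r x y \<longleftrightarrow> key x < key y" if "x \<in> A \<union> B" "y \<in> A \<union> B" for x y
    using that inj unfolding strictly_before_def r_def inj_on_def by (auto simp: order_less_le)
  have "Bs_before i = rank i * q" if i: "i \<in> A" for i
  proof -
    have fi: "f i < m + 1" using f i by (auto simp: bij_betw_def)
    have "{i' \<in> A. strictly_before r i' i} = {i' \<in> A. f i' < f i}"
      using i by (auto simp: before keyA simp del: mult_Suc_right)
    then have "rank i = f i"
      using card_bij_less[OF f, of "f i"] fi by (simp add: rank_def)
    moreover have "{j \<in> B. strictly_before r j i} = {j \<in> B. g j < f i * q}"
      using i iff by (auto simp: before keyA keyB simp del: mult_Suc_right)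
    moreover have "f i * q \<le> q * m"
      using fi by simp
    ultimately show ?thesis
      using card_bij_less[OF g, of "f i * q"] by (simp add: Bs_before_def)
  qed
  then show ?thesis using card_sep_quads_eq[OF cA cB] lin by blast
qed

section \<open>Symmetry under permutations of the two parts\<close>

definition relabel :: "('a \<Rightarrow> 'a) \<Rightarrow> ('a \<times> 'a) set \<Rightarrow> ('a \<times> 'a) set" where
  "relabel h r = map_prod h h ` r"

definition relabel_quad :: "('a \<Rightarrow> 'a) \<Rightarrow> 'a \<times> 'a \<times> 'a \<times> 'a \<Rightarrow> 'a \<times> 'a \<times> 'a \<times> 'a" where
  "relabel_quad h = (\<lambda>(i, i', j, j'). (h i, h i', h j, h j'))"

lemma in_relabel_iff: "bij h \<Longrightarrow> (h x, h y) \<in> relabel h r \<longleftrightarrow> (x, y) \<in> r"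
  unfolding relabel_def by (force simp: bij_def inj_eq)

lemma inj_relabel: "bij h \<Longrightarrow> inj (relabel h)"
  unfolding relabel_def
  by (meson bij_is_inj inj_image_eq_iff inj_onI prod.inj_map)

lemma linear_order_on_relabel:
  assumes h: "bij h" "h ` V = V" and r: "linear_order_on V r"
  shows "linear_order_on V (relabel h r)"
proof -
  note iff = in_relabel_iff[OF h(1)]
  have ex: "\<exists>x'. x = h x'" for x using h(1) by (metis bij_pointE)
  have sub: "r \<subseteq> V \<times> V" and rf: "refl_on V r" and tr: "trans r" and an: "antisym r" and to: "total_on V r"
    using r by (auto simp: linear_order_on_def partial_order_on_def preorder_on_def)
  have V: "h x \<in> V \<longleftrightarrow> x \<in> V" for x
    using h by (metis bij_is_inj inj_image_mem_iff)
  have "relabel h r \<subseteq> V \<times> V"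
    using sub V by (auto simp: relabel_def)
  moreover have "refl_on V (relabel h r)"
    using rf unfolding refl_on_def by (metis ex iff V)
  moreover have "trans (relabel h r)"
    using tr unfolding trans_def by (metis ex iff)
  moreover have "antisym (relabel h r)"
    using an unfolding antisym_def by (metis ex iff)
  moreover have "total_on V (relabel h r)"
    using to unfolding total_on_def by (metis ex iff V)
  ultimately show ?thesis
    by (simp add: linear_order_on_def partial_order_on_def preorder_on_def)
qed

lemma quad_sep_relabel:
  assumes "bij h"
  shows "quad_sep (relabel h r) (relabel_quad h p) \<longleftrightarrow> quad_sep r p"
  using assms
  by (cases p) (simp add: quad_sep_def relabel_quad_def separates_def all_precede_def
      in_relabel_iff bij_is_inj inj_eq)

text \<open>A permutation preserving both parts permutes the quadruples and carries those separated
  by \<open>r\<close> to those separated by the relabelled ordering. Hence relabelling keeps an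
  optimal ordering optimal.\<close>

lemma card_sep_quads_relabel:
  assumes h: "bij h" "h ` A = A" "h ` B = B"
  shows "card (sep_quads A B (relabel h r)) = card (sep_quads A B r)"
proof -
  have inj: "inj (relabel_quad h)"
    using h(1) by (auto simp: inj_def relabel_quad_def bij_def)
  have mem: "h x \<in> A \<longleftrightarrow> x \<in> A" "h x \<in> B \<longleftrightarrow> x \<in> B" for x
    using h by (metis bij_is_inj inj_image_mem_iff)+
  have quads: "relabel_quad h p \<in> edge_quads A B \<longleftrightarrow> p \<in> edge_quads A B" for p
    using h(1) by (cases p) (simp add: relabel_quad_def edge_quads_def mem bij_is_inj inj_eq)
  have surj: "\<exists>p'. p = relabel_quad h p'" for p
    using h(1) unfolding relabel_quad_def by (cases p) (simp, metis bij_pointE)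
  have "sep_quads A B (relabel h r) = relabel_quad h ` sep_quads A B r"
    unfolding sep_quads_def using quads surj quad_sep_relabel[OF h(1)] by (auto simp: image_iff) metis
  then show ?thesis using inj by (simp add: card_image inj_on_subset)
qed

lemma ex_perm_two_points:
  assumes "a \<in> S" "a' \<in> S" "a \<noteq> a'" "b \<in> S" "b' \<in> S" "b \<noteq> b'"
  shows "\<exists>h. bij h \<and> h ` S = S \<and> (\<forall>x. x \<notin> S \<longrightarrow> h x = x) \<and> h a = b \<and> h a' = b'"
proof -
  let ?t = "transpose a b"
  \<comment> \<open>The first transposition sends \<open>a\<close> to \<open>b\<close>. The second
    corrects the image of \<open>a'\<close> and fixes \<open>b\<close>, since neither of the points
    it exchanges is \<open>b\<close>.\<close>
  let ?h = "transpose (?t a') b' \<circ> ?t"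
  have ta': "?t a' \<in> S" "?t a' \<noteq> b"
    using assms by (auto simp: transpose_def)
  have "bij ?h" by (intro bij_comp) auto
  moreover have "?h ` S = S"
    using assms ta' by (simp only: image_comp[symmetric] transpose_image_eq)
  moreover have "\<forall>x. x \<notin> S \<longrightarrow> ?h x = x"
    using assms ta' by (metis comp_apply transpose_apply_other)
  moreover have "?h a = b" "?h a' = b'"
    using assms ta' by (auto simp: transpose_apply_other)
  ultimately show ?thesis by blast
qed

text \<open>The two parts can be permuted independently: one permutation adjusts the vertices in
  \<open>A\<close> and fixes \<open>B\<close> pointwise, the other does the reverse.\<close>

lemma edge_quads_transitive:
  assumes "A \<inter> B = {}" "p \<in> edge_quads A B" "p' \<in> edge_quads A B"
  shows "\<exists>h. bij h \<and> h ` A = A \<and> h ` B = B \<and> relabel_quad h p = p'"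
proof -
  obtain i i' j j' where p: "p = (i, i', j, j')" by (cases p)
  obtain k k' l l' where p': "p' = (k, k', l, l')" by (cases p')
  note mem = assms(2,3)[unfolded p p' edge_quads_def, simplified]
  obtain h where h: "bij h" "h ` A = A" "\<forall>x. x \<notin> A \<longrightarrow> h x = x" "h i = k" "h i' = k'"
    using ex_perm_two_points[of i A i' k k'] mem by auto
  obtain g where g: "bij g" "g ` B = B" "\<forall>x. x \<notin> B \<longrightarrow> g x = x" "g j = l" "g j' = l'"
    using ex_perm_two_points[of j B j' l l'] mem by auto
  have gA: "x \<in> A \<Longrightarrow> g x = x" and hB: "x \<in> B \<Longrightarrow> h x = x" for x
    using g h assms(1) by auto
  have "(g \<circ> h) ` A = A" using h(2) gA by (simp only: image_comp[symmetric]) simp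
  moreover have "(g \<circ> h) ` B = B" using g(2) hB by (simp only: image_comp[symmetric]) simp
  moreover have "relabel_quad (g \<circ> h) p = p'"
    using h g gA hB mem by (simp add: p p' relabel_quad_def)
  ultimately show ?thesis using bij_comp[OF h(1) g(1)] by blast
qed

section \<open>Double counting and the fractional limit\<close>

text \<open>Both sides count incidences between quadruples and the entries of \<open>rs\<close>,
  repeated entries included.\<close>

lemma sum_length_filter_quad_sep:
  assumes "finite A" "finite B"
  shows "(\<Sum>p\<in>edge_quads A B. length (filter (\<lambda>r. quad_sep r p) rs))
    = (\<Sum>r\<leftarrow>rs. card (sep_quads A B r))"
proof (induction rs)
  case (Cons r rs)
  have "(\<Sum>p\<in>edge_quads A B. length (filter (\<lambda>r. quad_sep r p) (r # rs)))
    = (\<Sum>p\<in>edge_quads A B. (if quad_sep r p then 1 else 0) + length (filter (\<lambda>r. quad_sep r p) rs))"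
    by (intro sum.cong) auto
  also have "\<dots> = card (sep_quads A B r) + (\<Sum>r\<leftarrow>rs. card (sep_quads A B r))"
    using finite_edge_quads[OF assms] by (simp add: sum.distrib Cons.IH sep_quads_def sum.If_cases Int_def)
  finally show ?case by simp
qed simp

text \<open>The counting bound holds for every positive \<open>t\<close>. The matching lists are
  built only for multiples of a constant \<open>c\<close>, which is enough for a liminf.\<close>

lemma frac_sep_dim_bipartite:
  fixes A B :: "'a set"
  assumes fin: "finite A" "finite B" and disj: "A \<inter> B = {}"
    and le: "\<And>r. linear_order_on (A \<union> B) r \<Longrightarrow> card (sep_quads A B r) \<le> M"
    and ex: "\<exists>r. linear_order_on (A \<union> B) r \<and> card (sep_quads A B r) = M"
    and M: "M > 0"
  shows "frac_sep_dim (A \<union> B) {{x, y} | x y. x \<in> A \<and> y \<in> B}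
    = ereal (real (card (edge_quads A B)) / real M)"
proof -
  define V E P where "V = A \<union> B" and "E = {{x, y} | x y. x \<in> A \<and> y \<in> B}" and "P = edge_quads A B"
  define L where "L = real (card P) / real M"
  have sep_iff: "separating_list V E t rs \<longleftrightarrow> (\<forall>r\<in>set rs. linear_order_on V r) \<and>
      (\<forall>p\<in>P. t \<le> length (filter (\<lambda>r. quad_sep r p) rs))" for t rs
  proof -
    have "(\<forall>e\<in>E. \<forall>f\<in>E. nonincident e f \<longrightarrow> Q e f) \<longleftrightarrow> (\<forall>(i, i', j, j')\<in>P. Q {i, j} {i', j'})" for Q
    proof
      assume *: "\<forall>e\<in>E. \<forall>f\<in>E. nonincident e f \<longrightarrow> Q e f"
      have "Q {i, j} {i', j'}" if "(i, i', j, j') \<in> P" for i i' j j'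
      proof -
        have "{i, j} \<in> E" "{i', j'} \<in> E" "nonincident {i, j} {i', j'}"
          using that disj by (auto simp: P_def edge_quads_def E_def nonincident_def)
        then show ?thesis using * by blast
      qed
      then show "\<forall>(i, i', j, j')\<in>P. Q {i, j} {i', j'}" by blast
    next
      assume *: "\<forall>(i, i', j, j')\<in>P. Q {i, j} {i', j'}"
      show "\<forall>e\<in>E. \<forall>f\<in>E. nonincident e f \<longrightarrow> Q e f"
      proof (intro ballI impI)
        fix e f assume "e \<in> E" "f \<in> E" and n: "nonincident e f"
        then obtain i i' j j' where ef: "e = {i, j}" "f = {i', j'}" "i \<in> A" "j \<in> B" "i' \<in> A" "j' \<in> B"
          unfolding E_def by blast
        then have "(i, i', j, j') \<in> P" using n by (auto simp: P_def edge_quads_def nonincident_def)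
        then show "Q e f" using * ef by blast
      qed
    qed
    then show ?thesis
      unfolding separating_list_def quad_sep_def by (simp add: case_prod_beta')
  qed

  \<comment> \<open>All optimal orderings are collected because this set is closed under
    relabelling, which a single optimal ordering is not in general.\<close>
  define Opt where "Opt = {r. linear_order_on V r \<and> card (sep_quads A B r) = M}"
  have "Opt \<subseteq> Pow (V \<times> V)"
    by (auto simp: Opt_def linear_order_on_def partial_order_on_def preorder_on_def)
  then have finOpt: "finite Opt"
    using fin by (rule_tac finite_subset) (auto simp: V_def)
  then obtain os where os: "set os = Opt" "distinct os" using finite_distinct_list by blast
  have "os \<noteq> []" using ex os(1) by (auto simp: Opt_def V_def)
  have "P \<noteq> {}"
    using ex M by (auto simp: P_def sep_quads_def)
  then obtain p0 where p0: "p0 \<in> P" by blast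
  define hits where "hits p = length (filter (\<lambda>r. quad_sep r p) os)" for p
  have hits_card: "hits p = card {r \<in> Opt. quad_sep r p}" for p
    unfolding hits_def using os by (metis distinct_card distinct_filter set_filter)
  \<comment> \<open>A permutation carrying \<open>p\<close> to \<open>p'\<close> injects the optimal
    orderings separating \<open>p\<close> into those separating \<open>p'\<close>. Exchanging
    \<open>p\<close> and \<open>p'\<close> gives equality.\<close>
  have hits_le: "hits p \<le> hits p'" if pp: "p \<in> P" "p' \<in> P" for p p'
  proof -
    obtain h where h: "bij h" "h ` A = A" "h ` B = B" "relabel_quad h p = p'"
      using edge_quads_transitive[OF disj] pp unfolding P_def by blast
    have "h ` V = V" using h by (simp add: V_def image_Un)
    then have "relabel h ` {r \<in> Opt. quad_sep r p} \<subseteq> {r \<in> Opt. quad_sep r p'}"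
      using linear_order_on_relabel[OF h(1)] card_sep_quads_relabel[OF h(1-3)]
        quad_sep_relabel[OF h(1), of _ p] h(4) by (auto simp: Opt_def)
    moreover have "inj_on (relabel h) {r \<in> Opt. quad_sep r p}"
      using inj_relabel[OF h(1)] by (rule inj_on_subset) simp
    ultimately show ?thesis
      unfolding hits_card using finOpt by (intro card_inj_on_le) auto
  qed
  define c where "c = hits p0"
  have hits: "hits p = c" if "p \<in> P" for p
    using hits_le that p0 by (simp add: c_def le_antisym)
  \<comment> \<open>Incidences between quadruples and optimal orderings are counted from both sides;
    the result fixes the ratio of \<open>length os\<close> to \<open>c\<close>.\<close>
  have "card P * c = (\<Sum>p\<in>P. hits p)" using hits by simp
  also have "\<dots> = (\<Sum>r\<leftarrow>os. card (sep_quads A B r))"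
    unfolding P_def hits_def by (rule sum_length_filter_quad_sep[OF fin])
  also have "\<dots> = (\<Sum>r\<leftarrow>os. M)"
    using os(1) by (intro arg_cong[of _ _ sum_list] map_cong) (auto simp: Opt_def)
  also have "\<dots> = length os * M" by (simp add: sum_list_triv)
  finally have eq: "card P * c = length os * M" .
  then have c: "c > 0" using \<open>os \<noteq> []\<close> M by (cases c) auto
  have ratio: "real (length os) / real c = L"
    using arg_cong[OF eq, of real] c M by (simp add: L_def field_simps)

  have sep_rep: "separating_list V E (k * c) (concat (replicate k os))" for k
  proof -
    have "length (filter (\<lambda>r. quad_sep r p) (concat (replicate k os))) = k * hits p" for p
      unfolding hits_def by (induction k) auto
    then show ?thesis
      unfolding sep_iff using hits os(1) by (auto simp: Opt_def)
  qed
  have upper: "sep_dim (k * c) V E \<le> k * length os" for k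
    unfolding sep_dim_def using sep_rep[of k]
    by (intro Least_le exI[of _ "concat (replicate k os)"]) (simp add: length_concat sum_list_replicate)

  have lower: "L \<le> real (sep_dim t V E) / real t" if t: "t > 0" for t
  proof -
    \<comment> \<open>Some list must exist for the \<open>LEAST\<close> in \<open>sep_dim\<close> to
      be attained; \<open>t\<close> copies of \<open>os\<close> separate each quadruple
      \<open>t * c\<close> times, which is at least \<open>t\<close>.\<close>
    have "separating_list V E t (concat (replicate t os))"
    proof -
      have "t \<le> t * c" using c by simp
      then show ?thesis using sep_rep[of t] unfolding sep_iff by (meson le_trans)
    qed
    then have "\<exists>n rs. length rs = n \<and> separating_list V E t rs" by blast
    then have "\<exists>rs. length rs = sep_dim t V E \<and> separating_list V E t rs"
      unfolding sep_dim_def by (rule LeastI_ex)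
    then obtain rs where rs: "length rs = sep_dim t V E" "separating_list V E t rs" by blast
    have "card P * t = (\<Sum>p\<in>P. t)" by simp
    also have "\<dots> \<le> (\<Sum>p\<in>P. length (filter (\<lambda>r. quad_sep r p) rs))"
      using rs(2) by (intro sum_mono) (simp add: sep_iff)
    also have "\<dots> = (\<Sum>r\<leftarrow>rs. card (sep_quads A B r))"
      unfolding P_def by (rule sum_length_filter_quad_sep[OF fin])
    also have "\<dots> \<le> (\<Sum>r\<leftarrow>rs. M)"
      using rs(2) le by (intro sum_list_mono) (auto simp: sep_iff V_def[symmetric])
    also have "\<dots> = sep_dim t V E * M" by (simp add: sum_list_triv rs(1))
    finally have "real (card P) * real t \<le> real (sep_dim t V E) * real M"
      by (metis of_nat_le_iff of_nat_mult)
    then show ?thesis using t M by (simp add: L_def field_simps)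
  qed

  let ?X = "\<lambda>t. ereal (real (sep_dim t V E) / real t)"
  \<comment> \<open>The index 0 is left out, as the quotient there is 0 by the convention on
    division.\<close>
  have "ereal L \<le> liminf ?X"
    using lower by (intro Liminf_bounded) (auto intro!: eventually_sequentiallyI[of 1])
  moreover have "liminf ?X \<le> ereal L"
  proof -
    have "strict_mono (\<lambda>k. Suc k * c)" using c by (intro strict_monoI) simp
    \<comment> \<open>Passing to a subsequence can only raise the liminf. Using \<open>Suc k\<close>
      keeps the factor nonzero that is cancelled below.\<close>
    then have "liminf ?X \<le> liminf (?X \<circ> (\<lambda>k. Suc k * c))" by (rule liminf_subseq_mono)
    also have "\<dots> \<le> liminf (\<lambda>k::nat. ereal L)"
    proof (intro Liminf_mono always_eventually allI)
      fix k :: nat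
      have "real (sep_dim (Suc k * c) V E) / real (Suc k * c) \<le> real (Suc k * length os) / real (Suc k * c)"
        using upper[of "Suc k"] by (intro divide_right_mono) (simp_all only: of_nat_le_iff of_nat_0_le_iff)
      also have "\<dots> = L" unfolding ratio[symmetric] of_nat_mult by (rule mult_divide_mult_cancel_left) simp
      finally show "(?X \<circ> (\<lambda>k. Suc k * c)) k \<le> ereal L" by simp
    qed
    finally show ?thesis by (simp add: Liminf_const)
  qed
  ultimately show ?thesis
    unfolding frac_sep_dim_def V_def E_def L_def P_def by (rule_tac order_antisym)
qed

section \<open>Evaluating the ratio for the complete bipartite graph\<close>

theorem mainTheorem10:
  fixes m q :: nat
  assumes "m > 0" and "q > 0" and "m * q > 1"
  shows "frac_sep_dim (complete_bipartite_verts (m + 1) (q * m))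
           (complete_bipartite_edges (m + 1) (q * m)) =
         ereal (3 * (1 - ((real q + 1) * real m - 2) /
                         ((2 * real m + 1) * real m * real q - real m - 2)))"
proof -
  define A B :: "(nat + nat) set" where "A = Inl ` {..<m + 1}" and "B = Inr ` {..<q * m}"
  have fin: "finite A" "finite B" and disj: "A \<inter> B = {}"
    by (auto simp: A_def B_def)
  have cA: "card A = m + 1" and cB: "card B = q * m"
    by (simp_all add: A_def B_def card_image)
  have V: "complete_bipartite_verts (m + 1) (q * m) = A \<union> B"
    by (simp add: complete_bipartite_verts_def A_def B_def Plus_def)
  have E: "complete_bipartite_edges (m + 1) (q * m) = {{x, y} | x y. x \<in> A \<and> y \<in> B}"
    unfolding complete_bipartite_edges_def A_def B_def by blast
  obtain r0 where r0: "linear_order_on (A \<union> B) r0"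
      "real (card (sep_quads A B r0)) = max_separated m q"
    using ex_optimal_order[OF fin disj cA cB assms(2)] by blast
  define M where "M = card (sep_quads A B r0)"
  have le: "card (sep_quads A B r) \<le> M" if "linear_order_on (A \<union> B) r" for r
  proof -
    interpret ordered_bipartition A B r using fin disj that by unfold_locales
    show ?thesis using card_sep_quads_le[OF cA cB] r0(2) unfolding M_def by linarith
  qed
  define D where "D = (2 * real m + 1) * real m * real q - real m - 2"
  define b where "b = real q * real m"
  have b: "b \<ge> 2" using assms(3) unfolding b_def
    by (metis Suc_leI mult.commute numeral_2_eq_2 of_nat_le_iff of_nat_mult of_nat_numeral One_nat_def)
  have Db: "D = (2 * real m + 1) * b - real m - 2" by (simp add: D_def b_def)
  have "(2 * real m + 1) * 2 \<le> (2 * real m + 1) * b" using b by (intro mult_left_mono) auto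
  \<comment> \<open>With \<open>b\<close> at least 2, \<open>D\<close> is at least 2 (2 m + 1) - m -
    2 = 3 m.\<close>
  then have D: "D > 0" using assms(1) unfolding Db by simp
  \<comment> \<open>Taking the factor (m + 1) b / 6 out of \<open>max_separated\<close> leaves 3 m
    (b - 1) - (m - 1) (b - 2), and this is \<open>D\<close>.\<close>
  have MD: "real M = (real m + 1) * b * D / 6"
    unfolding M_def r0(2) max_separated_def min_deficit_def Db
    by (simp add: b_def field_simps power2_eq_square)
  moreover have "(real m + 1) * b * D / 6 > 0" using D b by simp
  ultimately have "real M > 0" by simp
  then have "M > 0" by simp
  then have "frac_sep_dim (A \<union> B) {{x, y} | x y. x \<in> A \<and> y \<in> B}
      = ereal (real (card (edge_quads A B)) / real M)"
    using r0(1) by (intro frac_sep_dim_bipartite[OF fin disj le]) (auto simp: M_def)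
  moreover have "real (card (edge_quads A B)) = (real m + 1) * real m * (b * (b - 1))"
  proof -
    have "real (q * m - 1) = b - 1"
      using assms by (subst of_nat_diff) (simp_all add: b_def Suc_leI)
    then show ?thesis
      by (simp add: card_edge_quads[OF fin] cA cB b_def distrib_right)
  qed
  moreover have "(real m + 1) * real m * (b * (b - 1)) / real M = 6 * real m * (b - 1) / D"
  proof -
    define u where "u = (real m + 1) * b"
    have "u > 0" using b by (simp add: u_def)
    have "(real m + 1) * real m * (b * (b - 1)) / real M = u * (real m * (b - 1)) / (u * (D / 6))"
      by (simp add: MD u_def)
    also have "\<dots> = 6 * real m * (b - 1) / D"
      using \<open>u > 0\<close> by (subst mult_divide_mult_cancel_left) auto
    finally show ?thesis .
  qed
  moreover have "6 * real m * (b - 1) / D = 3 * (1 - ((real q + 1) * real m - 2) / D)"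
  proof -
    have "3 * (1 - ((real q + 1) * real m - 2) / D) = 3 * (D - ((real q + 1) * real m - 2)) / D"
      using D by (simp add: field_simps)
    \<comment> \<open>Here (q + 1) m = b + m, so the bracket collapses to 2 m (b - 1).\<close>
    also have "3 * (D - ((real q + 1) * real m - 2)) = 6 * real m * (b - 1)"
      by (simp add: Db b_def algebra_simps)
    finally show ?thesis ..
  qed
  ultimately show ?thesis unfolding V E D_def by (simp only:)
qed

end
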